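(* Let $X$ be an absolutely continuous nonnegative random variable with PDF $f$ and CDF $F$ such that $F(t)>0$ for all $t>0$. Let $\{X_n,n\ge 1\}$ be the sequence of random variables with CDFs $F_1=F$, $F_{n+1}=F_n(1+T_n)$ and PDFs $f_1=f$, $f_{n+1}=T_nf_n$, where $T_n=-\log F_n$, and let $\tau_n=f_n/F_n$. Then for all $t>0$, $n\ge 1$ and $s\in\mathbb R$, $$\widetilde{\mathbf T}_sF_{n+1}(t)=[1+T_n(t)]\,\widetilde{\mathbf T}_sF_n(t)+\widetilde{\mathbf T}_sq_n(s,t),$$ where $q_n(s,t)=\tau_n(t)\,\widetilde{\mathbf T}_sF_n(t)$.
   Context: For a function $h$ on $(0,\infty)$ (integrable on bounded intervals) and $s\in\mathbb R$, the operator $\widetilde{\mathbf T}_s$ is $$\widetilde{\mathbf T}_sh(t)=\int_0^te^{-s(t-x)}h(x)\,{\rm d}x,\qquad t>0.$$ In $\widetilde{\mathbf T}_sq_n(s,t)$ the operator acts on the second variable: $\widetilde{\mathbf T}_sq_n(s,t)=\int_0^te^{-s(t-x)}q_n(s,x)\,{\rm d}x$. The sequence is defined by $X_1\stackrel{D}{=}X$ and $[X_{n+1}\,|\,X_n=t]\stackrel{D}{=}[X_n\,|\,X_n\le t]$ for $t>0$, $n\ge1$; equivalently the CDFs and PDFs satisfy the stated recursions on $(0,\infty)$. *)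

theory Defs
  imports "HOL-Probability.Probability"
begin

text \<open>The integrals below are Lebesgue integrals over \<open>(0, t)\<close>. Functions on \<open>(0, \<infinity>)\<close> are
  represented by total functions of which only the values at positive arguments are used.\<close>

definition T_tilde :: "real \<Rightarrow> (real \<Rightarrow> real) \<Rightarrow> real \<Rightarrow> real" where
  "T_tilde s h t = (LBINT x:{0<..<t}. exp (- s * (t - x)) * h x)"

definition neg_log :: "(real \<Rightarrow> real) \<Rightarrow> real \<Rightarrow> real" where
  "neg_log G t = - ln (G t)"

definition reversed_hazard :: "(real \<Rightarrow> real) \<Rightarrow> (real \<Rightarrow> real) \<Rightarrow> real \<Rightarrow> real" where
  "reversed_hazard g G t = g t / G t"

definition q_fun :: "(real \<Rightarrow> real) \<Rightarrow> (real \<Rightarrow> real) \<Rightarrow> real \<Rightarrow> real \<Rightarrow> real" where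
  "q_fun g G s t = reversed_hazard g G t * T_tilde s G t"

text \<open>The density is required to be nonnegative everywhere, since \<open>ennreal\<close> sends negative
  reals to \<open>0\<close>.\<close>

definition has_pdf :: "'a measure \<Rightarrow> ('a \<Rightarrow> real) \<Rightarrow> (real \<Rightarrow> real) \<Rightarrow> bool" where
  "has_pdf M X f \<longleftrightarrow> (\<forall>x. 0 \<le> f x) \<and> distributed M lborel X (\<lambda>x. ennreal (f x))"

definition has_cdf :: "'a measure \<Rightarrow> ('a \<Rightarrow> real) \<Rightarrow> (real \<Rightarrow> real) \<Rightarrow> bool" where
  "has_cdf M X F \<longleftrightarrow> X \<in> borel_measurable M \<and> F = cdf (distr M borel X)"

end

theory Submission
  imports Defs
begin

text \<open>Subtracting the first term of the right-hand side leaves an integral of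
  \<open>F\<^sub>n(u) (T\<^sub>n(u) - T\<^sub>n(t))\<close>. Since \<open>T\<^sub>n(u) - T\<^sub>n(t)\<close> is the integral of \<open>\<tau>\<^sub>n\<close> over \<open>(u, t)\<close>,
  Tonelli's theorem over \<open>0 < u < x < t\<close> turns this into the iterated operator. The density need not
  be continuous, so the logarithmic derivative is integrated without differentiating \<open>F\<^sub>n\<close>: over a
  short interval the error of the formula is quadratic in the increment of \<open>F\<^sub>n\<close>, and repeated
  bisection in the values of \<open>F\<^sub>n\<close> makes the total error vanish.\<close>

section \<open>Integrating the logarithmic derivative of a continuous monotone function\<close>

lemma eq_of_quadratic_increments:
  fixes D G :: "real \<Rightarrow> real"
  assumes "a \<le> b" and cont: "continuous_on {a..b} G"
    and bound: "\<And>u v. a \<le> u \<Longrightarrow> u \<le> v \<Longrightarrow> v \<le> b \<Longrightarrow> \<bar>D v - D u\<bar> \<le> C * (G v - G u)\<^sup>2"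
  shows "D b = D a"
proof -
  \<comment> \<open>Each round halves the bound. Splitting at a point with the mean value of
    \<open>G u\<close> and \<open>G v\<close> halves both increments, so each squared increment is a
    quarter of the old one and the two together are a half. The claim ranges over all subintervals
    so that the induction hypothesis applies to both pieces.\<close>
  have bisect: "\<bar>D v - D u\<bar> \<le> C * (G v - G u)\<^sup>2 * (1 / 2) ^ k"
    if "a \<le> u" "u \<le> v" "v \<le> b" for k u v
    using that
  proof (induction k arbitrary: u v)
    case 0
    then show ?case using bound by simp
  next
    case (Suc k)
    have "continuous_on {u..v} G"
      using cont by (rule continuous_on_subset) (use Suc.prems in auto)
    \<comment> \<open>The intermediate value is taken from connectedness of the image, since either
      of \<open>G u\<close> and \<open>G v\<close> may be the larger.\<close>
    then have "connected (G ` {u..v})" by (intro connected_continuous_image) auto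
    moreover have "G u \<in> G ` {u..v}" "G v \<in> G ` {u..v}" using Suc.prems by auto
    ultimately have "(G u + G v) / 2 \<in> G ` {u..v}"
      using connectedD_interval[of "G ` {u..v}" "G u" "G v" "(G u + G v) / 2"]
        connectedD_interval[of "G ` {u..v}" "G v" "G u" "(G u + G v) / 2"]
      by (cases "G u \<le> G v") (auto simp: field_simps)
    then obtain w where w: "u \<le> w" "w \<le> v" "G w = (G u + G v) / 2" by auto
    have halves: "G w - G u = (G v - G u) / 2" "G v - G w = (G v - G u) / 2"
      using w by (auto simp: field_simps)
    have "\<bar>D v - D u\<bar> \<le> \<bar>D w - D u\<bar> + \<bar>D v - D w\<bar>" by linarith
    also have "\<dots> \<le> C * (G w - G u)\<^sup>2 * (1 / 2) ^ k + C * (G v - G w)\<^sup>2 * (1 / 2) ^ k"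
      using Suc.prems w by (intro add_mono Suc.IH) auto
    also have "\<dots> = C * (G v - G u)\<^sup>2 * (1 / 2) ^ Suc k"
      by (simp add: halves power_divide)
    finally show ?case .
  qed
  have "(\<lambda>k. C * (G b - G a)\<^sup>2 * (1 / 2) ^ k) \<longlonglongrightarrow> C * (G b - G a)\<^sup>2 * 0"
    by (intro tendsto_mult_left LIMSEQ_realpow_zero) auto
  then have "\<bar>D b - D a\<bar> \<le> C * (G b - G a)\<^sup>2 * 0"
    by (rule LIMSEQ_le_const) (use bisect[of a b] \<open>a \<le> b\<close> in auto)
  then show ?thesis by simp
qed

text \<open>Over \<open>{u<..v}\<close> both the integral of \<open>g / G\<close> and the increment
  of \<open>ln G\<close> lie between \<open>(G v - G u) / G v\<close> and
  \<open>(G v - G u) / G u\<close>: the former because \<open>G\<close> is monotone, the latter by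
  the tangent bound for \<open>ln\<close>. They differ by at most the gap
  \<open>(G v - G u)^2 / (G u * G v)\<close>, which is quadratic in the increment of
  \<open>G\<close>.\<close>

lemma log_derivative_integral:
  fixes g G :: "real \<Rightarrow> real"
  assumes "a \<le> b" and cont: "continuous_on {a..b} G" and meas: "G \<in> borel_measurable borel"
    and g0: "\<And>x. 0 \<le> g x" and gint: "set_integrable lborel {a<..b} g"
    and incr: "\<And>u v. a \<le> u \<Longrightarrow> u \<le> v \<Longrightarrow> v \<le> b \<Longrightarrow> G v - G u = (LBINT x:{u<..v}. g x)"
    and pos: "0 < G a"
  shows "set_integrable lborel {a<..b} (\<lambda>x. g x / G x)"
    and "(LBINT x:{a<..b}. g x / G x) = ln (G b) - ln (G a)"
proof -
  have mono: "G u \<le> G v" if "a \<le> u" "u \<le> v" "v \<le> b" for u v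
  proof -
    have "0 \<le> (LBINT x:{u<..v}. g x)"
      unfolding set_lebesgue_integral_def by (intro integral_nonneg_AE) (auto simp: g0)
    then show ?thesis using incr[OF that] by simp
  qed
  have gmeas: "(\<lambda>x. indicator {a<..b} x *\<^sub>R g x) \<in> borel_measurable lborel"
    using gint unfolding set_integrable_def by (rule borel_measurable_integrable)
  have posG: "0 < G x" if "a \<le> x" "x \<le> b" for x
    using mono[of a x] pos that by simp
  show int: "set_integrable lborel {a<..b} (\<lambda>x. g x / G x)"
    unfolding set_integrable_def
  proof (rule Bochner_Integration.integrable_bound)
    show "integrable lborel (\<lambda>x. (indicator {a<..b} x *\<^sub>R g x) / G a)"
      using gint unfolding set_integrable_def by (rule integrable_divide)
    \<comment> \<open>Only the restriction of \<open>g\<close> to the interval is known to be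
      measurable, so the indicator is grouped with \<open>g\<close> before dividing by
      \<open>G x\<close>.\<close>
    have "(\<lambda>x. (indicator {a<..b} x *\<^sub>R g x) / G x) \<in> borel_measurable lborel"
      using gmeas meas by (intro borel_measurable_divide) auto
    then show "(\<lambda>x. indicator {a<..b} x *\<^sub>R (g x / G x)) \<in> borel_measurable lborel"
      by simp
    show "AE x in lborel. norm (indicator {a<..b} x *\<^sub>R (g x / G x))
        \<le> norm ((indicator {a<..b} x *\<^sub>R g x) / G a)"
    proof (intro AE_I2)
      fix x
      show "norm (indicator {a<..b} x *\<^sub>R (g x / G x)) \<le> norm ((indicator {a<..b} x *\<^sub>R g x) / G a)"
        using mono[of a x] posG[of x] pos g0[of x]
        by (auto simp: indicator_def intro!: divide_left_mono mult_pos_pos)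
    qed
  qed
  define D where "D v = (LBINT x:{a<..v}. g x / G x) - ln (G v)" for v
  have "D b = D a"
  \<comment> \<open>The constant comes from \<open>G u * G v \<ge> G a * G a\<close>, as
    \<open>G a\<close> is the least value of \<open>G\<close> on the interval.\<close>
  proof (rule eq_of_quadratic_increments[where C = "1 / (G a)\<^sup>2", OF \<open>a \<le> b\<close> cont])
    fix u v assume uv: "a \<le> u" "u \<le> v" "v \<le> b"
    define H where "H = (LBINT x:{u<..v}. g x / G x)"
    have sub: "set_integrable lborel {u<..v} g" "set_integrable lborel {u<..v} (\<lambda>x. g x / G x)"
      "set_integrable lborel {a<..u} (\<lambda>x. g x / G x)"
      using uv by (auto intro: set_integrable_subset[OF gint] set_integrable_subset[OF int])
    have pu: "0 < G u" "0 < G v" "G a \<le> G u" "G u \<le> G v" "G a \<le> G v"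
      using uv posG mono by auto
    have "{a<..v} = {a<..u} \<union> {u<..v}" using uv by auto
    then have "(LBINT x:{a<..v}. g x / G x) = (LBINT x:{a<..u}. g x / G x) + H"
      unfolding H_def using sub by (simp add: set_integral_Un)
    then have D: "D v - D u = H - (ln (G v) - ln (G u))" by (simp add: D_def)
    have "(LBINT x:{u<..v}. g x / G v) \<le> H"
      unfolding H_def
    proof (rule set_integral_mono)
      fix x assume "x \<in> {u<..v}"
      then show "g x / G v \<le> g x / G x"
        using mono[of x v] posG[of x] pu uv g0[of x]
        by (intro divide_left_mono mult_pos_pos) auto
    qed (use sub in auto)
    then have lower: "(G v - G u) / G v \<le> H" using incr[OF uv] by simp
    have "H \<le> (LBINT x:{u<..v}. g x / G u)"
      unfolding H_def
    proof (rule set_integral_mono)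
      fix x assume "x \<in> {u<..v}"
      then show "g x / G x \<le> g x / G u"
        using mono[of u x] posG[of x] pu uv g0[of x]
        by (intro divide_left_mono mult_pos_pos) auto
    qed (use sub in auto)
    then have upper: "H \<le> (G v - G u) / G u" using incr[OF uv] by simp
    have "ln (G v) - ln (G u) \<le> (G v - G u) / G u" "ln (G u) - ln (G v) \<le> (G u - G v) / G v"
      using pu by (auto intro: ln_diff_le)
    moreover have "(G u - G v) / G v = - ((G v - G u) / G v)" by (simp add: minus_divide_left)
    ultimately have "\<bar>D v - D u\<bar> \<le> (G v - G u) / G u - (G v - G u) / G v"
      using lower upper D by linarith
    also have "\<dots> = (G v - G u)\<^sup>2 / (G u * G v)"
      using pu by (simp add: field_simps power2_eq_square)
    also have "\<dots> \<le> (G v - G u)\<^sup>2 / (G a * G a)"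
      using pu pos by (intro divide_left_mono mult_mono mult_pos_pos) auto
    finally show "\<bar>D v - D u\<bar> \<le> 1 / (G a)\<^sup>2 * (G v - G u)\<^sup>2"
      by (simp add: power2_eq_square)
  qed
  \<comment> \<open>The interval \<open>{a<..a}\<close> is empty, so \<open>D a\<close> is just
    \<open>- ln (G a)\<close>.\<close>
  then show "(LBINT x:{a<..b}. g x / G x) = ln (G b) - ln (G a)"
    by (simp add: D_def set_lebesgue_integral_def)
qed

section \<open>Tonelli's theorem and integrability for the exponential operator\<close>

text \<open>Both sides are the integral of \<open>exp (- s * (t - u)) * G u * h x\<close> over the
  triangle \<open>0 < u < x < t\<close>. Integrating in \<open>x\<close> first produces the tail
  integral of \<open>h\<close>; integrating in \<open>u\<close> first produces the iterated
  operator, because the exponential factors at the intermediate point \<open>x\<close>.\<close>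

lemma T_tilde_tail_integral:
  fixes G h :: "real \<Rightarrow> real"
  assumes [measurable]: "G \<in> borel_measurable borel" "h \<in> borel_measurable borel"
    and G0: "\<And>x. 0 \<le> G x" and h0: "\<And>x. 0 \<le> h x"
    and Gint: "\<And>x. 0 < x \<Longrightarrow> x < t \<Longrightarrow> set_integrable lborel {0<..<x} (\<lambda>u. exp (- s * (x - u)) * G u)"
    and hint: "\<And>u. 0 < u \<Longrightarrow> u < t \<Longrightarrow> set_integrable lborel {u<..<t} h"
  shows "T_tilde s (\<lambda>u. G u * (LBINT x:{u<..<t}. h x)) t = T_tilde s (\<lambda>x. h x * T_tilde s G x) t"
proof -
  let ?K = "\<lambda>u x. ennreal (indicator {p. 0 < fst p \<and> fst p < snd p \<and> snd p < t} (u, x)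
      * (exp (- s * (t - u)) * G u * h x))"
  let ?L = "\<lambda>u. indicator {0<..<t} u * (exp (- s * (t - u)) * (G u * (LBINT x:{u<..<t}. h x)))"
  let ?R = "\<lambda>x. indicator {0<..<t} x * (exp (- s * (t - x)) * (h x * T_tilde s G x))"
  have tail0: "0 \<le> (LBINT x:{u<..<t}. h x)" for u
    unfolding set_lebesgue_integral_def by (intro integral_nonneg_AE) (auto simp: h0)
  have T0: "0 \<le> T_tilde s G x" for x
    unfolding T_tilde_def set_lebesgue_integral_def by (intro integral_nonneg_AE) (auto simp: G0)
  have tail_meas [measurable]: "(\<lambda>u. LBINT x:{u<..<t}. h x) \<in> borel_measurable borel"
  proof -
    \<comment> \<open>The moving interval is written as a section of a fixed set in the plane. The
      integrand is then jointly measurable, so its integral is measurable in the parameter.\<close>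
    have "(\<lambda>u. LINT x|lborel. indicator {p. fst p < snd p \<and> snd p < t} (u, x) * h x)
        \<in> borel_measurable borel"
      by measurable
    then show ?thesis
      by (simp add: set_lebesgue_integral_def indicator_def)
  qed
  have T_meas [measurable]: "T_tilde s G \<in> borel_measurable borel"
  proof -
    have "(\<lambda>x. LINT u|lborel. indicator {p. 0 < snd p \<and> snd p < fst p} (x, u)
        * (exp (- s * (x - u)) * G u)) \<in> borel_measurable borel"
      by measurable
    then show ?thesis
      by (simp add: T_tilde_def[abs_def] set_lebesgue_integral_def indicator_def)
  qed
  have left: "(\<integral>\<^sup>+x. ?K u x \<partial>lborel) = ennreal (?L u)" for u
  proof (cases "0 < u \<and> u < t")
    case True
    have "(\<integral>\<^sup>+x. ?K u x \<partial>lborel)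
        = (\<integral>\<^sup>+x. ennreal (exp (- s * (t - u)) * G u) * ennreal (indicator {u<..<t} x *\<^sub>R h x) \<partial>lborel)"
      using True G0 h0 by (intro nn_integral_cong) (auto simp: indicator_def ennreal_mult)
    also have "\<dots> = ennreal (exp (- s * (t - u)) * G u)
        * (\<integral>\<^sup>+x. ennreal (indicator {u<..<t} x *\<^sub>R h x) \<partial>lborel)"
      by (intro nn_integral_cmult) measurable
    also have "(\<integral>\<^sup>+x. ennreal (indicator {u<..<t} x *\<^sub>R h x) \<partial>lborel) = ennreal (LBINT x:{u<..<t}. h x)"
      unfolding set_lebesgue_integral_def
      using hint[of u] True h0 unfolding set_integrable_def
      by (intro nn_integral_eq_integral) auto
    finally show ?thesis using True G0 tail0 by (simp add: ennreal_mult mult.assoc)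
  next
    case False
    then have "?K u x = 0" for x by (auto simp: indicator_def)
    with False show ?thesis by (auto simp: indicator_def)
  qed
  have right: "(\<integral>\<^sup>+u. ?K u x \<partial>lborel) = ennreal (?R x)" for x
  proof (cases "0 < x \<and> x < t")
    case True
    have "(\<integral>\<^sup>+u. ?K u x \<partial>lborel)
        = (\<integral>\<^sup>+u. ennreal (exp (- s * (t - x)) * h x)
            * ennreal (indicator {0<..<x} u *\<^sub>R (exp (- s * (x - u)) * G u)) \<partial>lborel)"
    proof (intro nn_integral_cong)
      fix u
      have "exp (- s * (t - u)) = exp (- s * (t - x)) * exp (- s * (x - u))"
        by (simp add: exp_add[symmetric] algebra_simps)
      then show "?K u x = ennreal (exp (- s * (t - x)) * h x)
          * ennreal (indicator {0<..<x} u *\<^sub>R (exp (- s * (x - u)) * G u))"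
        using True G0[of u] h0[of x]
        by (simp only: ennreal_mult[symmetric] mult_nonneg_nonneg exp_ge_zero
            indicator_pos_le scaleR_nonneg_nonneg)
          (auto simp: indicator_def mult_ac)
    qed
    also have "\<dots> = ennreal (exp (- s * (t - x)) * h x)
        * (\<integral>\<^sup>+u. ennreal (indicator {0<..<x} u *\<^sub>R (exp (- s * (x - u)) * G u)) \<partial>lborel)"
      by (intro nn_integral_cmult) measurable
    also have "(\<integral>\<^sup>+u. ennreal (indicator {0<..<x} u *\<^sub>R (exp (- s * (x - u)) * G u)) \<partial>lborel)
        = ennreal (T_tilde s G x)"
      unfolding set_lebesgue_integral_def T_tilde_def
      using Gint[of x] True G0 unfolding set_integrable_def
      by (intro nn_integral_eq_integral) auto
    finally show ?thesis using True h0 T0 by (simp add: ennreal_mult mult.assoc)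
  next
    case False
    then have "?K u x = 0" for u by (auto simp: indicator_def)
    with False show ?thesis by (auto simp: indicator_def)
  qed
  have swap: "(\<integral>\<^sup>+u. \<integral>\<^sup>+x. ?K u x \<partial>lborel \<partial>lborel) = (\<integral>\<^sup>+x. \<integral>\<^sup>+u. ?K u x \<partial>lborel \<partial>lborel)"
    by (rule lborel_pair.Fubini'[symmetric]) measurable
  \<comment> \<open>For a nonnegative measurable integrand this equation holds even if the integral
    is infinite: the Bochner integral and \<open>enn2real\<close> then both give \<open>0\<close>.
    Hence equality of the two nonnegative integrals suffices.\<close>
  have "(LINT u|lborel. ?L u) = enn2real (\<integral>\<^sup>+u. ennreal (?L u) \<partial>lborel)"
    by (rule integral_eq_nn_integral) (auto simp: G0 tail0)
  also have "\<dots> = enn2real (\<integral>\<^sup>+x. ennreal (?R x) \<partial>lborel)"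
    using swap by (simp only: left right)
  also have "\<dots> = (LINT x|lborel. ?R x)"
    by (rule integral_eq_nn_integral[symmetric]) (auto simp: h0 T0)
  finally show ?thesis
    unfolding T_tilde_def[of s _ t] set_lebesgue_integral_def by simp
qed

lemma set_integrable_T_tilde:
  fixes G :: "real \<Rightarrow> real"
  assumes [measurable]: "G \<in> borel_measurable borel"
    and bounded: "\<And>x. 0 < x \<Longrightarrow> x < t \<Longrightarrow> \<bar>G x\<bar> \<le> B"
  shows "set_integrable lborel {0<..<t} (\<lambda>x. exp (- s * (t - x)) * G x)"
  unfolding set_integrable_def
proof (rule Bochner_Integration.integrable_bound)
  \<comment> \<open>For either sign of \<open>s\<close>, the exponent \<open>- s * (t - x)\<close>
    is at most \<open>\<bar>s\<bar> * t\<close> when \<open>0 < x < t\<close>.\<close>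
  show "integrable lborel (\<lambda>x. indicator {0<..<t} x *\<^sub>R (exp (\<bar>s\<bar> * t) * \<bar>B\<bar>))"
    by (intro integrable_scaleR_left integrable_real_indicator)
      (auto simp: emeasure_bounded_finite simp flip: infinity_ennreal_def)
  show "AE x in lborel. norm (indicator {0<..<t} x *\<^sub>R (exp (- s * (t - x)) * G x))
      \<le> norm (indicator {0<..<t} x *\<^sub>R (exp (\<bar>s\<bar> * t) * \<bar>B\<bar>))"
  proof (intro AE_I2)
    fix x
    have "exp (- s * (t - x)) \<le> exp (\<bar>s\<bar> * t) \<and> \<bar>G x\<bar> \<le> \<bar>B\<bar>" if "0 < x" "x < t"
    proof -
      have "- s * (t - x) \<le> \<bar>s\<bar> * (t - x)" using that by (intro mult_right_mono) auto
      also have "\<dots> \<le> \<bar>s\<bar> * t" using that by (intro mult_left_mono) auto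
      finally show ?thesis using bounded[OF that] by auto
    qed
    then show "norm (indicator {0<..<t} x *\<^sub>R (exp (- s * (t - x)) * G x))
      \<le> norm (indicator {0<..<t} x *\<^sub>R (exp (\<bar>s\<bar> * t) * \<bar>B\<bar>))"
      by (auto simp: indicator_def abs_mult intro!: mult_mono)
  qed
qed measurable

section \<open>Regularity of a distribution function with a density\<close>

lemma
  assumes "prob_space M" and pdf: "has_pdf M Y g" and cdf: "has_cdf M Y G"
  shows pdf_measurable: "g \<in> borel_measurable borel"
    and pdf_integrable: "integrable lborel g"
    and cdf_increment: "u \<le> v \<Longrightarrow> G v - G u = (LBINT x:{u<..v}. g x)"
    and cdf_continuous: "isCont G x"
    and cdf_measurable: "G \<in> borel_measurable borel"
    and cdf_nonneg: "0 \<le> G x"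
    and cdf_le_1: "G x \<le> 1"
proof -
  have g0: "0 \<le> g x" for x using pdf by (simp add: has_pdf_def)
  have dist: "distributed M lborel Y (\<lambda>x. ennreal (g x))"
    using pdf by (simp add: has_pdf_def)
  have Y: "Y \<in> borel_measurable M" and G: "G = cdf (distr M borel Y)"
    using cdf by (auto simp: has_cdf_def)
  interpret prob_space M by fact
  interpret Y: real_distribution "distr M borel Y"
    using Y by (rule real_distribution_distr)
  have g_meas: "g \<in> borel_measurable lborel"
    using distributed_real_measurable[OF _ dist] g0 by simp
  show "g \<in> borel_measurable borel" using g_meas by simp
  \<comment> \<open>The density describes the law on \<open>lborel\<close> and the distribution
    function the law on \<open>borel\<close>; these measures agree because the two sigma-algebras
    do.\<close>
  have "distr M borel Y = distr M lborel Y" by (rule distr_cong) auto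
  also have "\<dots> = density lborel (\<lambda>x. ennreal (g x))"
    using dist by (simp add: distributed_def)
  finally have law: "distr M borel Y = density lborel (\<lambda>x. ennreal (g x))" .
  have law_eq: "emeasure (distr M borel Y) A = (\<integral>\<^sup>+x. ennreal (g x) * indicator A x \<partial>lborel)"
    if "A \<in> sets borel" for A
    unfolding law using that g_meas by (intro emeasure_density) auto
  have "(\<integral>\<^sup>+x. ennreal (g x) \<partial>lborel) = 1"
    using law_eq[of UNIV] Y.emeasure_space_1 by simp
  then show int: "integrable lborel g"
    using g_meas g0 by (intro integrableI_nonneg) auto
  show "G v - G u = (LBINT x:{u<..v}. g x)" if "u \<le> v"
  proof (cases "u = v")
    case True
    then show ?thesis by (simp add: set_lebesgue_integral_def)
  next
    case False
    have "ennreal (measure (distr M borel Y) {u<..v})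
        = (\<integral>\<^sup>+x. ennreal (indicator {u<..v} x *\<^sub>R g x) \<partial>lborel)"
      unfolding Y.emeasure_eq_measure[symmetric]
      by (subst law_eq) (auto intro!: nn_integral_cong simp: indicator_def)
    also have "\<dots> = ennreal (LBINT x:{u<..v}. g x)"
      unfolding set_lebesgue_integral_def using int g0
      by (intro nn_integral_eq_integral integrable_mult_indicator) auto
    finally have "measure (distr M borel Y) {u<..v} = (LBINT x:{u<..v}. g x)"
      using g0 by (subst (asm) ennreal_inj)
        (auto simp: set_lebesgue_integral_def intro!: integral_nonneg_AE)
    then show ?thesis using Y.cdf_diff_eq[of u v] False that by (simp add: G)
  qed
  \<comment> \<open>A law with a density has no atoms, and absence of an atom at \<open>x\<close> is
    continuity of its distribution function there.\<close>
  have "AE y in lborel. ennreal (g y) * indicator {x} y = 0"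
    using AE_lborel_singleton[of x] by eventually_elim auto
  then have "emeasure (distr M borel Y) {x} = 0"
    using g_meas by (subst law_eq) (auto simp: nn_integral_0_iff_AE)
  then show "isCont G x" by (simp add: G Y.isCont_cdf measure_def)
  have "mono G" by (auto simp: G mono_def Y.cdf_nondecreasing)
  then show "G \<in> borel_measurable borel" by (rule borel_measurable_mono)
  show "0 \<le> G x" "G x \<le> 1" by (auto simp: G Y.cdf_nonneg Y.cdf_bounded_prob)
qed

text \<open>Starting at a point where \<open>G\<close> is positive keeps the logarithm finite; the
  integral grows without bound as \<open>G u\<close> tends to \<open>0\<close>. The right endpoint
  \<open>t\<close> is a null set, which allows the passage from half-open to open intervals.\<close>

lemma reversed_hazard_integral:
  assumes "prob_space M" and pdf: "has_pdf M Y g" and cdf: "has_cdf M Y G"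
    and "0 < G u" "u \<le> t"
  shows "set_integrable lborel {u<..<t} (reversed_hazard g G)"
    and "(LBINT x:{u<..<t}. reversed_hazard g G x) = neg_log G u - neg_log G t"
proof -
  have g0: "0 \<le> g x" for x using pdf by (simp add: has_pdf_def)
  have sub: "set_integrable lborel {u<..t} g"
    using pdf_integrable[OF assms(1-3)] unfolding set_integrable_def
    by (intro integrable_mult_indicator) auto
  have cont: "continuous_on {u..t} G"
    using cdf_continuous[OF assms(1-3)] by (simp add: continuous_at_imp_continuous_on)
  have incr: "G y - G x = (LBINT z:{x<..y}. g z)" if "x \<le> y" for x y
    using assms(1-3) that by (rule cdf_increment)
  note log = log_derivative_integral[OF \<open>u \<le> t\<close> cont cdf_measurable[OF assms(1-3)] g0 sub
      incr \<open>0 < G u\<close>]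
  show int: "set_integrable lborel {u<..<t} (reversed_hazard g G)"
    unfolding reversed_hazard_def[abs_def] by (rule set_integrable_subset[OF log(1)]) auto
  have "AE x in lborel. indicator {u<..<t} x *\<^sub>R reversed_hazard g G x
      = indicator {u<..t} x *\<^sub>R (g x / G x)"
    using AE_lborel_singleton[of t]
    by eventually_elim (auto simp: indicator_def reversed_hazard_def)
  then have "(LBINT x:{u<..<t}. reversed_hazard g G x) = (LBINT x:{u<..t}. g x / G x)"
    unfolding set_lebesgue_integral_def
    using int log(1) unfolding set_integrable_def
    by (intro integral_cong_AE) (auto dest: borel_measurable_integrable)
  then show "(LBINT x:{u<..<t}. reversed_hazard g G x) = neg_log G u - neg_log G t"
    using log(2) by (simp add: neg_log_def)
qed

section \<open>The recursion for the transformed distribution functions\<close>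

theorem theorem10:
  fixes M :: "'a measure"
    and X :: "'a \<Rightarrow> real" and f F :: "real \<Rightarrow> real"
    and Xs :: "nat \<Rightarrow> 'a \<Rightarrow> real" and fs Fs :: "nat \<Rightarrow> real \<Rightarrow> real"
    and s t :: real and n :: nat
  assumes "prob_space M"
    and "has_pdf M X f" and "has_cdf M X F"
    and "AE \<omega> in M. 0 \<le> X \<omega>"
    and "\<And>x. x > 0 \<Longrightarrow> F x > 0"
    and "\<And>k. k \<ge> 1 \<Longrightarrow> has_cdf M (Xs k) (Fs k)"
    and "\<And>k. k \<ge> 1 \<Longrightarrow> has_pdf M (Xs k) (fs k)"
    and "\<And>x. x > 0 \<Longrightarrow> Fs 1 x = F x"
    and "\<And>k x. k \<ge> 1 \<Longrightarrow> x > 0 \<Longrightarrow> Fs (k + 1) x = Fs k x * (1 + neg_log (Fs k) x)"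
    and "\<And>x. x > 0 \<Longrightarrow> fs 1 x = f x"
    and "\<And>k x. k \<ge> 1 \<Longrightarrow> x > 0 \<Longrightarrow> fs (k + 1) x = neg_log (Fs k) x * fs k x"
    and "t > 0" and "n \<ge> 1"
  shows "T_tilde s (Fs (n + 1)) t
       = (1 + neg_log (Fs n) t) * T_tilde s (Fs n) t
         + T_tilde s (\<lambda>x. q_fun (fs n) (Fs n) s x) t"
proof -
  let ?G = "Fs n" and ?r = "reversed_hazard (fs n) (Fs n)"
  \<comment> \<open>Positivity passes along the recursion: a distribution function is at most
    \<open>1\<close>, so the factor \<open>1 + neg_log (Fs k) x\<close> is at least
    \<open>1\<close>.\<close>
  have pos: "0 < Fs k x" if "k \<ge> 1" "0 < x" for k x
    using that(1)
  proof (induction k rule: nat_induct_at_least)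
    case base
    then show ?case using assms(5,8) that by simp
  next
    case (Suc k)
    have "Fs k x \<le> 1"
      using Suc.hyps assms(1,6,7) by (intro cdf_le_1[where M = M and Y = "Xs k"]) auto
    then have "0 \<le> neg_log (Fs k) x" using Suc.IH by (simp add: neg_log_def)
    then have "0 < Fs k x * (1 + neg_log (Fs k) x)"
      using Suc.IH by (intro mult_pos_pos) auto
    then show ?case using assms(9)[OF Suc.hyps \<open>0 < x\<close>] by simp
  qed
  note law = assms(1) assms(7)[OF \<open>n \<ge> 1\<close>] assms(6)[OF \<open>n \<ge> 1\<close>]
  note [measurable] = pdf_measurable[OF law] cdf_measurable[OF law]
  have r_meas: "?r \<in> borel_measurable borel"
    unfolding reversed_hazard_def[abs_def] by measurable
  have G0: "0 \<le> ?G x" for x by (rule cdf_nonneg[OF law])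
  have G1: "\<bar>?G x\<bar> \<le> 1" for x using cdf_le_1[OF law, of x] G0[of x] by simp
  \<comment> \<open>This covers points where \<open>Fs n\<close> vanishes, since division by zero
    yields \<open>0\<close>.\<close>
  have r0: "0 \<le> ?r x" for x
    using law(2) G0 by (simp add: has_pdf_def reversed_hazard_def)
  have Gint: "set_integrable lborel {0<..<x} (\<lambda>u. exp (- s * (x - u)) * ?G u)" for x
    using G1 by (intro set_integrable_T_tilde) auto
  have tail: "set_integrable lborel {u<..<t} ?r"
    "(LBINT x:{u<..<t}. ?r x) = neg_log ?G u - neg_log ?G t" if "0 < u" "u < t" for u
    using reversed_hazard_integral[OF law, of u t] pos[OF \<open>n \<ge> 1\<close>] that by auto
  \<comment> \<open>On positive arguments, \<open>Fs (n + 1) u\<close> is \<open>d u\<close> plus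
    \<open>Fs n u\<close> times the factor \<open>1 + neg_log (Fs n) t\<close>, which does not
    depend on \<open>u\<close>.\<close>
  define d where "d u = ?G u * (neg_log ?G u - neg_log ?G t)" for u
  have d_meas: "d \<in> borel_measurable borel"
    unfolding d_def[abs_def] neg_log_def[abs_def] by measurable
  \<comment> \<open>Although \<open>neg_log (Fs n)\<close> may be unbounded near \<open>0\<close>,
    the factor \<open>Fs n\<close> compensates: \<open>- y * ln y \<le> 1 - y\<close> for
    \<open>0 < y \<le> 1\<close>, by the tangent bound for \<open>ln\<close> at
    \<open>1 / y\<close>.\<close>
  have d_bound: "\<bar>d u\<bar> \<le> 1 + \<bar>neg_log ?G t\<bar>" if "0 < u" for u
  proof -
    have Gu: "0 < ?G u" "?G u \<le> 1" using pos[OF \<open>n \<ge> 1\<close> that] G1[of u] by auto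
    have "- ln (?G u) \<le> 1 / ?G u - 1"
      using ln_le_minus_one[of "1 / ?G u"] Gu by (simp add: ln_div)
    then have "?G u * - ln (?G u) \<le> ?G u * (1 / ?G u - 1)"
      using Gu by (intro mult_left_mono) auto
    also have "\<dots> \<le> 1" using Gu by (simp add: field_simps)
    finally have "\<bar>?G u * neg_log ?G u\<bar> \<le> 1"
      using Gu by (simp add: neg_log_def abs_mult)
    moreover have "\<bar>?G u * neg_log ?G t\<bar> \<le> 1 * \<bar>neg_log ?G t\<bar>"
      unfolding abs_mult using G1[of u] by (intro mult_right_mono) auto
    ultimately show ?thesis by (simp add: d_def right_diff_distrib)
  qed
  have dint: "set_integrable lborel {0<..<t} (\<lambda>u. exp (- s * (t - u)) * d u)"
    using d_meas d_bound by (rule set_integrable_T_tilde)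
  have "T_tilde s (Fs (n + 1)) t
      = (LBINT u:{0<..<t}. (1 + neg_log ?G t) * (exp (- s * (t - u)) * ?G u)
          + exp (- s * (t - u)) * d u)"
    unfolding T_tilde_def
    using assms(9)[OF \<open>n \<ge> 1\<close>]
    by (intro set_lebesgue_integral_cong) (auto simp: d_def algebra_simps)
  also have "\<dots> = (1 + neg_log ?G t) * T_tilde s ?G t + T_tilde s d t"
    using Gint[of t] dint unfolding T_tilde_def by (simp add: set_integral_add)
  \<comment> \<open>The difference of logarithms in \<open>d\<close> becomes a tail integral of the
    reversed hazard rate, the form in which the order of integration can be exchanged.\<close>
  also have "T_tilde s d t = T_tilde s (\<lambda>u. ?G u * (LBINT x:{u<..<t}. ?r x)) t"
    unfolding T_tilde_def by (intro set_lebesgue_integral_cong) (auto simp: d_def tail)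
  also have "\<dots> = T_tilde s (\<lambda>x. ?r x * T_tilde s ?G x) t"
    by (rule T_tilde_tail_integral[OF cdf_measurable[OF law] r_meas G0 r0 Gint tail(1)])
  finally show ?thesis by (simp add: q_fun_def[abs_def])
qed

end
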